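(* Let $n\ge2$, $k\ge1$, and let $\ell\in\{0,1,\dots,n\}$ be such that $\ell\equiv k-2a\bmod 2n$ for some $a\in\{0,1,\dots,k\}$; let $a_\ell$ be the minimal such $a$. (i) For $\ell\in\{1,\dots,n-1\}$, the number of walks of $k$ steps from $0$ to $\ell$ on the affine Dynkin diagram of type $\hat{\mathsf D}_{n+2}$ is $\displaystyle\sum_{\substack{0\le b\le k\\ b\equiv a_\ell\bmod n}}\binom kb$. (ii) For $\ell\in\{0,n\}$, the number of walks of $k$ steps from $0$ to $\ell$ (respectively, to $\ell'$) on the affine Dynkin diagram of type $\hat{\mathsf D}_{n+2}$ is $\displaystyle\frac12\sum_{\substack{0\le b\le k\\ b\equiv a_\ell\bmod n}}\binom kb$.
   Context: The affine Dynkin diagram $\hat{\mathsf D}_{n+2}$ is the graph with nodes $0,0',1,2,\dots,n-1,n,n'$, consisting of the path $1-2-\cdots-(n-1)$ with nodes $0,0'$ joined to $1$ and nodes $n,n'$ joined to $n-1$ (for $n=2$: the four nodes $0,0',2,2'$ joined to $1$). *)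

theory Defs
  imports Complex_Main "HOL-Number_Theory.Cong" "Graph_Theory.Pair_Digraph"
begin

text \<open>\<open>Unprimed i\<close> is the node $i$, \<open>Primed i\<close> is the node $i'$.\<close>

datatype affD_node = Unprimed nat | Primed nat

text \<open>
  The affine Dynkin diagram of type $\hat{\mathsf D}_{n+2}$, meant for $n \ge 2$.  Following
  the Graph Theory library, an undirected simple graph is a symmetric digraph: each edge is
  listed once in \<open>affD_edges\<close>, and the graph has both arcs for it.
\<close>

definition affD_edges :: "nat \<Rightarrow> affD_node rel" where
  "affD_edges n =
     {(Unprimed i, Unprimed (i + 1)) | i. 1 \<le> i \<and> i + 1 \<le> n - 1}
     \<union> {(Unprimed 0, Unprimed 1), (Primed 0, Unprimed 1)}
     \<union> {(Unprimed n, Unprimed (n - 1)), (Primed n, Unprimed (n - 1))}"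

definition affD :: "nat \<Rightarrow> affD_node pair_pre_digraph" where
  "affD n = \<lparr> pverts = Unprimed ` {0..n} \<union> Primed ` {0, n},
              parcs = affD_edges n \<union> (affD_edges n)\<inverse> \<rparr>"

text \<open>A walk is given by its list of arcs, so its number of steps is the length of that list.\<close>

definition num_walks :: "('a, 'b) pre_digraph \<Rightarrow> nat \<Rightarrow> 'a \<Rightarrow> 'a \<Rightarrow> nat" where
  "num_walks G k u v = card {p. pre_digraph.awalk G u p v \<and> length p = k}"

text \<open>
  The minimal $a \in \{0,\dots,k\}$ with $\ell \equiv k - 2a \bmod 2n$; unspecified if there is
  none.  The congruence is over the integers, since $k - 2a$ may be negative.
\<close>

definition min_a :: "nat \<Rightarrow> nat \<Rightarrow> nat \<Rightarrow> nat" where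
  "min_a n k l = (LEAST a. a \<in> {0..k} \<and> [int l = int k - 2 * int a] (mod 2 * int n))"

lemma pair_graph_affD:
  assumes "n \<ge> 2"
  shows "pair_graph (affD n)"
proof -
  have fin: "finite (affD_edges n)"
  proof (rule finite_subset)
    show "affD_edges n \<subseteq> (Unprimed ` {0..n} \<union> Primed ` {0, n}) \<times> Unprimed ` {0..n}"
      using assms by (auto simp: affD_edges_def)
  qed simp
  show ?thesis
  proof unfold_locales
    show "symmetric (affD n)"
      by (auto simp: symmetric_def affD_def intro!: symI)
  qed (use assms fin in \<open>auto simp: affD_def affD_edges_def\<close>)
qed

lemma (in fin_digraph) finite_walks: "finite {p. awalk u p v \<and> length p = k}"
proof (rule finite_subset)
  show "{p. awalk u p v \<and> length p = k} \<subseteq> {p. set p \<subseteq> arcs G \<and> length p = k}"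
    by (auto simp: awalk_def)
qed (simp add: finite_lists_length_eq)

end

theory Submission
  imports Defs
begin

text \<open>
  Folding the cycle of length \<open>2n\<close> by the reflection \<open>j \<mapsto> -j\<close> gives a path \<open>0, \<dots>, n\<close>
  whose end points are the fixed points of the reflection.  The diagram arises from this path by
  splitting each end point into two nodes, and the walks from \<open>0\<close> on the diagram that end in
  the fibre over \<open>j\<close> are equinumerous with the walks from \<open>0\<close> to \<open>j\<close> on the cycle.  Both counts
  satisfy one recurrence in the number of steps: over an interior \<open>j\<close> the neighbours are the two
  adjacent fibres; over an end point each of the two nodes receives the walks that end at the
  single neighbour, while on the cycle the two neighbours are exchanged by the reflection and so
  receive equally many walks (\<open>fibre_walks_eq_cycle_walks\<close>).

  On the cycle a walk of \<open>k\<close> steps with \<open>b\<close> steps down ends at \<open>k - 2b\<close> modulo \<open>2n\<close>, so the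
  count is a sum of binomial coefficients over a residue class of \<open>b\<close> modulo \<open>n\<close>.  After at
  least one step, the two nodes over an end point are reached equally often because they have the
  same only neighbour, and this gives the factor one half.
\<close>

section \<open>Walks on a cycle\<close>

text \<open>
  The number of sequences of \<open>k\<close> steps \<open>\<plusminus>1\<close> that lead from \<open>0\<close> to \<open>j\<close> modulo \<open>m\<close>, that is,
  of \<open>k\<close>-step walks on the cycle of length \<open>m\<close> if \<open>m \<ge> 3\<close>, sorted by the number \<open>b\<close> of
  steps down.  Integer arguments make the recurrence and the reflection free of
  case distinctions.
\<close>

definition cycle_walks :: "nat \<Rightarrow> nat \<Rightarrow> int \<Rightarrow> nat" where
  "cycle_walks m k j = (\<Sum>b\<le>k. if [j = int k - 2 * int b] (mod int m) then k choose b else 0)"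

lemma cycle_walks_cong:
  assumes "[i = j] (mod int m)"
  shows "cycle_walks m k i = cycle_walks m k j"
proof -
  have "[i = x] (mod int m) \<longleftrightarrow> [j = x] (mod int m)" for x
    using assms by (meson cong_sym cong_trans)
  then show ?thesis by (simp add: cycle_walks_def)
qed

text \<open>Exchanging steps up and steps down is the substitution \<open>b \<mapsto> k - b\<close>.\<close>

lemma cycle_walks_minus: "cycle_walks m k (- j) = cycle_walks m k j"
proof -
  have "[- j = int k - 2 * int (k - b)] (mod int m) \<longleftrightarrow> [j = int k - 2 * int b] (mod int m)"
    if "b \<le> k" for b
  proof -
    have "[- j = int k - 2 * int (k - b)] (mod int m) \<longleftrightarrow> [- j = - (int k - 2 * int b)] (mod int m)"
      using that by (simp add: of_nat_diff algebra_simps)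
    then show ?thesis by (simp only: cong_minus_minus_iff)
  qed
  moreover have "k choose (k - b) = k choose b" if "b \<le> k" for b
    using that by (simp add: binomial_symmetric[symmetric])
  ultimately show ?thesis
    unfolding cycle_walks_def
    by (subst sum.atLeastAtMost_rev[of _ 0 k, simplified atLeast0AtMost])
       (intro sum.cong; simp)
qed

lemma cycle_walks_Suc:
  "cycle_walks m (Suc k) j = cycle_walks m k (j - 1) + cycle_walks m k (j + 1)"
proof -
  define P where "P b \<longleftrightarrow> [j = int (Suc k) - 2 * int b] (mod int m)" for b
  have down: "P b \<longleftrightarrow> [j - 1 = int k - 2 * int b] (mod int m)" for b
    by (simp add: P_def cong_iff_dvd_diff algebra_simps)
  have up: "P (Suc b) \<longleftrightarrow> [j + 1 = int k - 2 * int b] (mod int m)" for b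
    by (simp add: P_def cong_iff_dvd_diff algebra_simps)
  have "cycle_walks m (Suc k) j
      = (if P 0 then 1 else 0) + (\<Sum>b\<le>k. if P (Suc b) then Suc k choose Suc b else 0)"
    by (simp add: cycle_walks_def P_def sum.atMost_Suc_shift del: sum.atMost_Suc binomial_Suc_Suc)
  also have "(\<Sum>b\<le>k. if P (Suc b) then Suc k choose Suc b else 0)
      = (\<Sum>b\<le>k. if P (Suc b) then k choose b else 0)
        + (\<Sum>b\<le>k. if P (Suc b) then k choose Suc b else 0)"
    unfolding sum.distrib[symmetric] by (intro sum.cong) auto
  also have "(if P 0 then 1 else 0) + (\<dots>)
      = (\<Sum>b\<le>Suc k. if P b then k choose b else 0)
        + (\<Sum>b\<le>k. if P (Suc b) then k choose b else 0)"
    unfolding sum.atMost_Suc_shift by simp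
  also have "(\<Sum>b\<le>Suc k. if P b then k choose b else 0) = cycle_walks m k (j - 1)"
    by (simp add: cycle_walks_def down)
  also have "(\<Sum>b\<le>k. if P (Suc b) then k choose b else 0) = cycle_walks m k (j + 1)"
    by (simp add: cycle_walks_def up)
  finally show ?thesis .
qed

text \<open>
  Any single admissible \<open>a\<close> determines the residue class of all admissible \<open>b\<close>: the factor \<open>2\<close>
  cancels from the congruence together with the factor \<open>2\<close> of the modulus.
\<close>

lemma cycle_walks_eq_sum_residue_class:
  assumes "[j = int k - 2 * int a] (mod 2 * int n)"
  shows "cycle_walks (2 * n) k j = (\<Sum>b | b \<in> {0..k} \<and> [b = a] (mod n). k choose b)"
proof -
  have "[j = int k - 2 * int b] (mod 2 * int n) \<longleftrightarrow> [b = a] (mod n)" for b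
  proof -
    have "[j = int k - 2 * int b] (mod 2 * int n)
        \<longleftrightarrow> [int k - 2 * int a = int k - 2 * int b] (mod 2 * int n)"
      using assms by (meson cong_sym cong_trans)
    also have "\<dots> \<longleftrightarrow> 2 * int n dvd 2 * (int b - int a)"
      by (simp add: cong_iff_dvd_diff algebra_simps)
    also have "\<dots> \<longleftrightarrow> int n dvd int b - int a"
      by (subst dvd_mult_cancel_left) simp
    also have "\<dots> \<longleftrightarrow> [b = a] (mod n)"
      by (simp add: cong_iff_dvd_diff[symmetric] cong_int_iff)
    finally show ?thesis .
  qed
  then have "cycle_walks (2 * n) k j = (\<Sum>b\<le>k. if [b = a] (mod n) then k choose b else 0)"
    by (simp add: cycle_walks_def)
  also have "\<dots> = (\<Sum>b | b \<in> {..k} \<and> [b = a] (mod n). k choose b)"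
    by (rule sum.inter_filter[symmetric]) simp
  finally show ?thesis by (simp add: atLeast0AtMost)
qed

section \<open>Walks on a digraph by their last arc\<close>

lemma (in fin_digraph) num_walks_Suc:
  "num_walks G (Suc k) u v = (\<Sum>e\<in>in_arcs G v. num_walks G k u (tail G e))"
proof -
  let ?W = "\<lambda>k v. {p. awalk u p v \<and> length p = k}"
  have "?W (Suc k) v = (\<Union>e\<in>in_arcs G v. (\<lambda>p. p @ [e]) ` ?W k (tail G e))"
  proof (intro equalityI subsetI)
    fix p assume p: "p \<in> ?W (Suc k) v"
    then obtain q e where "p = q @ [e]" "length q = k"
      by (auto simp: length_Suc_conv_rev)
    moreover from this p have "e \<in> in_arcs G v" "awalk u q (tail G e)"
      by (auto simp: awalk_Cons_iff awalk_Nil_iff in_arcs_def)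
    ultimately show "p \<in> (\<Union>e\<in>in_arcs G v. (\<lambda>p. p @ [e]) ` ?W k (tail G e))"
      by blast
  qed (auto simp: awalk_Cons_iff awalk_Nil_iff)
  then have "num_walks G (Suc k) u v
      = (\<Sum>e\<in>in_arcs G v. card ((\<lambda>p. p @ [e]) ` ?W k (tail G e)))"
    unfolding num_walks_def
    by (simp only:) (rule card_UN_disjoint, auto simp: finite_walks)
  also have "\<dots> = (\<Sum>e\<in>in_arcs G v. num_walks G k u (tail G e))"
    unfolding num_walks_def by (intro sum.cong card_image) (auto simp: inj_on_def)
  finally show ?thesis .
qed

lemma (in fin_digraph) num_walks_0:
  assumes "u \<in> verts G"
  shows "num_walks G 0 u v = (if u = v then 1 else 0)"
proof -
  have "{p. awalk u p v \<and> length p = 0} = (if u = v then {[]} else {})"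
    using assms by (auto simp: awalk_Nil_iff)
  then show ?thesis by (simp add: num_walks_def)
qed

lemma (in pair_fin_digraph) num_walks_Suc_pair:
  "num_walks (with_proj G) (Suc k) u v
     = (\<Sum>w | (w, v) \<in> parcs G. num_walks (with_proj G) k u w)"
proof -
  have "in_arcs (with_proj G) v = (\<lambda>w. (w, v)) ` {w. (w, v) \<in> parcs G}"
    by (auto simp: in_arcs_def)
  then show ?thesis
    by (simp add: num_walks_Suc sum.reindex inj_on_def)
qed

section \<open>The affine Dynkin diagram as a folded cycle\<close>

text \<open>
  The nodes over \<open>j\<close> under the map \<open>j, j' \<mapsto> j\<close> from the diagram to the path \<open>0, \<dots>, n\<close>.
\<close>

definition fibre :: "nat \<Rightarrow> nat \<Rightarrow> affD_node set" where
  "fibre n j = (if j \<in> {0, n} then {Unprimed j, Primed j} else {Unprimed j})"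

text \<open>
  Stating the neighbours by fibres makes the nodes next to an end of the diagram, and the single
  interior node for \<open>n = 2\<close>, instances of the same formula as the other interior nodes.
\<close>

lemma affD_neighbours_interior:
  assumes "1 \<le> l" "l < n"
  shows "{w. (w, Unprimed l) \<in> parcs (affD n)} = fibre n (l - 1) \<union> fibre n (l + 1)"
  using assms by (auto simp: affD_def affD_edges_def fibre_def)

lemma affD_neighbours_0:
  assumes "n \<ge> 2" "v \<in> fibre n 0"
  shows "{w. (w, v) \<in> parcs (affD n)} = {Unprimed 1}"
  using assms by (auto simp: affD_def affD_edges_def fibre_def)

lemma affD_neighbours_n:
  assumes "n \<ge> 2" "v \<in> fibre n n"
  shows "{w. (w, v) \<in> parcs (affD n)} = {Unprimed (n - 1)}"
  using assms by (auto simp: affD_def affD_edges_def fibre_def)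

text \<open>
  Both sides start at \<open>k = 0\<close> with the empty walk alone and satisfy the same recurrence in \<open>k\<close>.
  Only sums over fibres can be compared from \<open>k = 0\<close> on: the empty walk ends at \<open>0\<close> but not at
  \<open>0'\<close>.
\<close>

lemma fibre_walks_eq_cycle_walks:
  assumes "n \<ge> 2" "l \<le> n"
  shows "(\<Sum>w\<in>fibre n l. num_walks (with_proj (affD n)) k (Unprimed 0) w)
           = cycle_walks (2 * n) k (int l)"
  using assms(2)
proof (induction k arbitrary: l)
  interpret pair_graph "affD n" by (rule pair_graph_affD) fact
  case 0
  have "[int l = 0] (mod int (2 * n)) \<longleftrightarrow> l = 0"
    using 0 assms(1) by (simp add: cong_def)
  moreover have "Unprimed 0 \<in> pverts (affD n)"
    by (simp add: affD_def)
  ultimately show ?case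
    using assms(1) by (simp add: cycle_walks_def num_walks_0 fibre_def)
next
  interpret pair_graph "affD n" by (rule pair_graph_affD) fact
  case (Suc k)
  let ?W = "\<lambda>k. num_walks (with_proj (affD n)) k (Unprimed 0)"
  have interior: "?W k (Unprimed j) = cycle_walks (2 * n) k (int j)" if "1 \<le> j" "j < n" for j
    using Suc.IH[of j] that by (simp add: fibre_def)
  consider "l = 0" | "l = n" | "1 \<le> l" "l < n"
    using Suc.prems by linarith
  then show ?case
  proof cases
    case 1
    have "(\<Sum>w\<in>fibre n 0. ?W (Suc k) w) = (\<Sum>w\<in>fibre n 0. ?W k (Unprimed 1))"
      using assms(1) by (intro sum.cong) (simp_all add: num_walks_Suc_pair affD_neighbours_0)
    also have "\<dots> = 2 * cycle_walks (2 * n) k 1"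
      using interior[of 1] assms(1) by (simp add: fibre_def)
    also have "\<dots> = cycle_walks (2 * n) (Suc k) 0"
      using cycle_walks_minus[of "2 * n" k 1] by (simp add: cycle_walks_Suc)
    finally show ?thesis using 1 by simp
  next
    case 2
    \<comment> \<open>Modulo \<open>2n\<close>, the neighbours \<open>n + 1\<close> and \<open>n - 1\<close> of \<open>n\<close> are negatives of each other.\<close>
    have "(\<Sum>w\<in>fibre n n. ?W (Suc k) w) = (\<Sum>w\<in>fibre n n. ?W k (Unprimed (n - 1)))"
      using assms(1) by (intro sum.cong) (simp_all add: num_walks_Suc_pair affD_neighbours_n)
    also have "\<dots> = 2 * cycle_walks (2 * n) k (int n - 1)"
      using interior[of "n - 1"] assms(1) by (simp add: fibre_def of_nat_diff)
    also have "\<dots> = cycle_walks (2 * n) (Suc k) (int n)"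
    proof -
      have "cycle_walks (2 * n) k (int n + 1) = cycle_walks (2 * n) k (- (int n - 1))"
        by (rule cycle_walks_cong) (simp add: cong_iff_dvd_diff)
      then have "cycle_walks (2 * n) k (int n + 1) = cycle_walks (2 * n) k (int n - 1)"
        by (simp only: cycle_walks_minus)
      then show ?thesis by (simp add: cycle_walks_Suc)
    qed
    finally show ?thesis using 2 by simp
  next
    case 3
    have "(\<Sum>w\<in>fibre n l. ?W (Suc k) w) = ?W (Suc k) (Unprimed l)"
      using 3 by (simp add: fibre_def)
    also have "\<dots> = (\<Sum>w\<in>fibre n (l - 1) \<union> fibre n (l + 1). ?W k w)"
      using 3 by (simp add: num_walks_Suc_pair affD_neighbours_interior)
    also have "\<dots> = (\<Sum>w\<in>fibre n (l - 1). ?W k w) + (\<Sum>w\<in>fibre n (l + 1). ?W k w)"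
      using 3 by (intro sum.union_disjoint) (auto simp: fibre_def)
    also have "\<dots> = cycle_walks (2 * n) k (int l - 1) + cycle_walks (2 * n) k (int l + 1)"
      using 3 Suc.IH[of "l - 1"] Suc.IH[of "l + 1"] by (simp add: of_nat_diff add.commute)
    finally show ?thesis by (simp add: cycle_walks_Suc)
  qed
qed

text \<open>
  The last step of a nonempty walk to either node comes from the neighbour that they share.
\<close>

lemma num_walks_Primed:
  assumes "n \<ge> 2" "k \<ge> 1" "l \<in> {0, n}"
  shows "num_walks (with_proj (affD n)) k u (Primed l)
           = num_walks (with_proj (affD n)) k u (Unprimed l)"
proof -
  interpret pair_graph "affD n" by (rule pair_graph_affD) fact
  obtain k' where k: "k = Suc k'" using assms(2) by (cases k) auto
  have "{w. (w, Primed l) \<in> parcs (affD n)} = {w. (w, Unprimed l) \<in> parcs (affD n)}"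
  proof (cases "l = 0")
    case True
    then show ?thesis using assms(1) by (simp add: fibre_def affD_neighbours_0)
  next
    case False
    then have "l = n" using assms(3) by simp
    then show ?thesis using assms(1) by (simp add: fibre_def affD_neighbours_n)
  qed
  then show ?thesis by (simp add: k num_walks_Suc_pair)
qed

theorem corollary3p34:
  fixes n k l :: nat
  assumes "n \<ge> 2" and "k \<ge> 1" and "l \<in> {0..n}"
    and "\<exists>a\<in>{0..k}. [int l = int k - 2 * int a] (mod 2 * int n)"
  shows "(l \<in> {1..n - 1} \<longrightarrow>
            num_walks (with_proj (affD n)) k (Unprimed 0) (Unprimed l)
              = (\<Sum>b | b \<in> {0..k} \<and> [b = min_a n k l] (mod n). k choose b))
       \<and> (l \<in> {0, n} \<longrightarrow>
            real (num_walks (with_proj (affD n)) k (Unprimed 0) (Unprimed l))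
              = 1 / 2 * (\<Sum>b | b \<in> {0..k} \<and> [b = min_a n k l] (mod n). real (k choose b))
          \<and> real (num_walks (with_proj (affD n)) k (Unprimed 0) (Primed l))
              = 1 / 2 * (\<Sum>b | b \<in> {0..k} \<and> [b = min_a n k l] (mod n). real (k choose b)))"
proof -
  let ?W = "num_walks (with_proj (affD n)) k (Unprimed 0)"
  let ?S = "\<Sum>b | b \<in> {0..k} \<and> [b = min_a n k l] (mod n). k choose b"
  have "\<exists>a. a \<in> {0..k} \<and> [int l = int k - 2 * int a] (mod 2 * int n)"
    using assms(4) by blast
  then have "[int l = int k - 2 * int (min_a n k l)] (mod 2 * int n)"
    unfolding min_a_def by (rule LeastI2_ex) blast
  then have fibre_sum: "(\<Sum>w\<in>fibre n l. ?W w) = ?S"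
    using assms(1,3) by (simp add: fibre_walks_eq_cycle_walks cycle_walks_eq_sum_residue_class)
  have "?W (Unprimed l) = ?S" if "l \<in> {1..n - 1}"
  proof -
    have "fibre n l = {Unprimed l}" using that assms(1) by (auto simp: fibre_def)
    then show ?thesis using fibre_sum by simp
  qed
  moreover have "?W (Primed l) = ?W (Unprimed l) \<and> 2 * ?W (Unprimed l) = ?S" if "l \<in> {0, n}"
  proof -
    have "?W (Primed l) = ?W (Unprimed l)"
      using assms(1,2) that by (rule num_walks_Primed)
    moreover have "fibre n l = {Unprimed l, Primed l}" using that by (simp only: fibre_def if_True)
    ultimately show ?thesis using fibre_sum by simp
  qed
  moreover have "(\<Sum>b | b \<in> {0..k} \<and> [b = min_a n k l] (mod n). real (k choose b)) = real ?S"
    by (simp only: of_nat_sum)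
  ultimately show ?thesis by (auto simp flip: of_nat_sum)
qed

end
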